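(* Consider the F-RAN system with pipelined fronthaul-edge transmission described in the context, with $n_T$ antennas at each EN, fractional cache size $\mu\in[0,1]$ and fronthaul rate $r\ge 0$. The minimum pipelined NDT satisfies $$\delta_P^*(\mu,r)\ge\delta_{p,lb}(\mu,r)=\begin{cases}\max\Big\{\dfrac{K_R(1-\mu K_T)}{K_Tr},\,1\Big\}, & \mu K_T<\big(1-\frac{K_Tr}{n_T}\big)^+,\\[2ex] \max\Big\{\dfrac{K_R}{m_p^*(\mu,r)n_T},\,1\Big\}, & \mu K_T\ge\big(1-\frac{K_Tr}{n_T}\big)^+,\end{cases}$$ where $$m_p^*(\mu,r)=\begin{cases}\max\{m_{eq}(\mu,r),1\}, & \mu K_T\le m_{max}-\frac{K_Tr}{m_{max}n_T},\\ m_{max}, & \mu K_T\ge m_{max}-\frac{K_Tr}{m_{max}n_T},\end{cases}\qquad m_{eq}(\mu,r)=\frac{\mu K_T}{2}+\frac{\sqrt{(\mu K_Tn_T)^2+4n_TK_Tr}}{2n_T},$$ with $m_{max}=\min\{K_T,\lceil K_R/n_T\rceil\}$ and $(x)^+=\max\{x,0\}$.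
   Context: F-RAN model with pipelined transmission. $K_T,K_R,n_T\ge 1$ and $N\ge K_R$ are integers; $[K]=\{1,\dots,K\}$. There are $K_T$ edge nodes (ENs) with $n_T$ antennas each, $K_R$ single-antenna users, and a cloud with a library of $N$ files $W_1,\dots,W_N$ of equal size. Each file is split into $F\ge 1$ equal packets, $\mathcal W_n=\{W_{n1},\dots,W_{nF}\}$ ($F$ is a free design parameter). $\mu\in[0,1]$ is the fractional cache size and $r\ge 0$ the fronthaul rate (each fronthaul link has capacity $r\log P$ bits per channel use, $P$ = SNR). Caching: EN $i$ stores sets $\mathcal C_{in}\subseteq\mathcal W_n$ with $|\mathcal C_{in}|\le \mu F$ for every $n$, chosen before the requests are known; $\mathcal C_i=\bigcup_n\mathcal C_{in}$. Delivery: user $k$ requests file $d_k\in[N]$; $\boldsymbol d=(d_1,\dots,d_{K_R})$. Delivery is organized in $B$ blocks. In each block $b$: (i) the cloud sends to each EN $i$ a set $\mathcal F_i(b)$ of (uncoded) packets of requested files; (ii) simultaneously, a set $\mathcal R(b)\subseteq[K_R]$ of users is served by one-shot linear precoding, each $k\in\mathcal R(b)$ with exactly one packet of $W_{d_k}$; the stream for user $k$ is sent with precoding vectors $\boldsymbol v_{i,k}\in\mathbb C^{n_T}$ by those ENs $i$ for which that packet lies in $\mathcal C_i\cup\bigcup_{b'<b}\mathcal F_i(b')$ (the other ENs use $\boldsymbol v_{i,k}=0$); decodability without interference means $\sum_i \boldsymbol h_{ki}^T\boldsymbol v_{i,k}\ne 0$ and $\sum_i \boldsymbol h_{k'i}^T\boldsymbol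 v_{i,k}=0$ for all $k'\in\mathcal R(b)\setminus\{k\}$, where $\boldsymbol h_{ki}=\boldsymbol h_{ki}(b)\in\mathbb C^{n_T}$ is the channel from EN $i$ to user $k$. After the $B$ blocks every user must have received all $F$ packets of its file. Delivery may depend on $\boldsymbol d$ and on the channels. The channels are arbitrary but non-degenerate: in each block, every square submatrix of the $K_R\times K_Tn_T$ matrix with rows $(\boldsymbol h_{k1}^T,\dots,\boldsymbol h_{kK_T}^T)$ is invertible. NDT (pipelined mode): each block lasts for the maximum of its fronthaul and edge durations, so for a policy and request $\boldsymbol d$ the normalized delivery time is $\sum_{b=1}^{B}\max\big\{\max_i|\mathcal F_i(b)|/(Fr),\,1/F\big\}$ (if $r=0$, nothing may be sent on the fronthaul and the fronthaul term is $0$); the NDT of the policy is the maximum over $\boldsymbol d$. $\bar\delta_P(\mu,r)$ is the infimum of the NDT over all $F\ge1$ and all policies ($+\infty$ if there is none), and the minimum pipelined NDT $\delta_P^*(\mu,r)$ is the lower convex envelope of $\bar\delta_P(\mu,r)$ as a function of $\mu\in[0,1]$ for fixed $r$. For $r=0$, a quotient with positive numerator and denominator $K_Tr$ is $+\infty$. *)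

theory Defs
  imports
    "HOL-Library.Extended_Real"
    "HOL-Library.FuncSet"
    "Jordan_Normal_Form.DL_Submatrix"
begin

text \<open>
  Files, packets, edge nodes (ENs), users and blocks are all numbered from 0. The packet
  with number \<open>f\<close> of file \<open>n\<close> is the pair \<open>(n, f)\<close>.
  Throughout, \<open>KT\<close> is the number of ENs, \<open>KR\<close> the number of users, \<open>nT\<close> the number of antennas
  per EN, \<open>N\<close> the number of files, \<open>r\<close> the fronthaul rate and \<open>\<mu>\<close> the fractional cache size;
  \<open>h b k i\<close> is the channel vector from EN \<open>i\<close> to user \<open>k\<close> in block \<open>b\<close>.
\<close>

type_synonym packet = "nat \<times> nat"
type_synonym channels = "nat \<Rightarrow> nat \<Rightarrow> nat \<Rightarrow> complex vec"

definition file_packets :: "nat \<Rightarrow> nat \<Rightarrow> packet set" where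
  "file_packets F n = {n} \<times> {..<F}"

definition channel_matrix :: "nat \<Rightarrow> nat \<Rightarrow> nat \<Rightarrow> channels \<Rightarrow> nat \<Rightarrow> complex mat" where
  "channel_matrix KT KR nT h b =
     mat KR (KT * nT) (\<lambda>(k, c). h b k (c div nT) $ (c mod nT))"

definition nondegenerate_channels :: "nat \<Rightarrow> nat \<Rightarrow> nat \<Rightarrow> channels \<Rightarrow> bool" where
  "nondegenerate_channels KT KR nT h \<longleftrightarrow>
     (\<forall>b. \<forall>k<KR. \<forall>i<KT. h b k i \<in> carrier_vec nT) \<and>
     (\<forall>b. \<forall>I J. I \<subseteq> {..<KR} \<longrightarrow> J \<subseteq> {..<KT * nT} \<longrightarrow> card I = card J \<longrightarrow>
        invertible_mat (submatrix (channel_matrix KT KR nT h b) I J))"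

text \<open>
  A schedule is the delivery for one request vector: in block \<open>b\<close> the cloud sends
  \<open>fronthaul i b\<close> to EN \<open>i\<close>, the users in \<open>served b\<close> are served, user \<open>k\<close> with the packet
  \<open>sent_packet b k\<close>, whose stream EN \<open>i\<close> precodes with \<open>precoder b i k\<close>.
\<close>

record schedule =
  num_blocks :: nat
  fronthaul :: "nat \<Rightarrow> nat \<Rightarrow> packet set"
  served :: "nat \<Rightarrow> nat set"
  sent_packet :: "nat \<Rightarrow> nat \<Rightarrow> packet"
  precoder :: "nat \<Rightarrow> nat \<Rightarrow> nat \<Rightarrow> complex vec"

text \<open>The set \<open>cached i n\<close> consists of the packets of file \<open>n\<close> stored at EN \<open>i\<close>.\<close>

record policy =
  num_packets :: nat
  cached :: "nat \<Rightarrow> nat \<Rightarrow> packet set"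
  schedule_for :: "(nat \<Rightarrow> nat) \<Rightarrow> schedule"

definition requests :: "nat \<Rightarrow> nat \<Rightarrow> (nat \<Rightarrow> nat) set" where
  "requests KR N = {..<KR} \<rightarrow>\<^sub>E {..<N}"

definition available :: "nat \<Rightarrow> (nat \<Rightarrow> nat \<Rightarrow> packet set) \<Rightarrow> schedule \<Rightarrow> nat \<Rightarrow> nat \<Rightarrow> packet set" where
  "available N C s i b = (\<Union>n<N. C i n) \<union> (\<Union>b'<b. fronthaul s i b')"

definition valid_fronthaul ::
    "nat \<Rightarrow> nat \<Rightarrow> real \<Rightarrow> nat \<Rightarrow> (nat \<Rightarrow> nat) \<Rightarrow> schedule \<Rightarrow> bool" where
  "valid_fronthaul KT KR r F d s \<longleftrightarrow>
     (\<forall>b<num_blocks s. \<forall>i<KT.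
        fronthaul s i b \<subseteq> (\<Union>k<KR. file_packets F (d k)) \<and>
        (r = 0 \<longrightarrow> fronthaul s i b = {}))"

definition valid_edge ::
    "nat \<Rightarrow> nat \<Rightarrow> nat \<Rightarrow> nat \<Rightarrow> channels \<Rightarrow> nat \<Rightarrow> (nat \<Rightarrow> nat \<Rightarrow> packet set) \<Rightarrow>
     (nat \<Rightarrow> nat) \<Rightarrow> schedule \<Rightarrow> bool" where
  "valid_edge KT KR nT N h F C d s \<longleftrightarrow>
     (\<forall>b<num_blocks s. served s b \<subseteq> {..<KR} \<and>
        (\<forall>k\<in>served s b.
           sent_packet s b k \<in> file_packets F (d k) \<and>
           (\<forall>i<KT. precoder s b i k \<in> carrier_vec nT \<and>
              (sent_packet s b k \<notin> available N C s i b \<longrightarrow> precoder s b i k = 0\<^sub>v nT)) \<and>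
           (\<Sum>i<KT. h b k i \<bullet> precoder s b i k) \<noteq> 0 \<and>
           (\<forall>k'\<in>served s b - {k}. (\<Sum>i<KT. h b k' i \<bullet> precoder s b i k) = 0)))"

definition all_delivered :: "nat \<Rightarrow> nat \<Rightarrow> (nat \<Rightarrow> nat) \<Rightarrow> schedule \<Rightarrow> bool" where
  "all_delivered KR F d s \<longleftrightarrow>
     (\<forall>k<KR. \<forall>p\<in>file_packets F (d k).
        \<exists>b<num_blocks s. k \<in> served s b \<and> sent_packet s b k = p)"

definition valid_policy ::
    "nat \<Rightarrow> nat \<Rightarrow> nat \<Rightarrow> nat \<Rightarrow> channels \<Rightarrow> real \<Rightarrow> real \<Rightarrow> policy \<Rightarrow> bool" where
  "valid_policy KT KR nT N h r \<mu> \<pi> \<longleftrightarrow>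
     num_packets \<pi> \<ge> 1 \<and>
     (\<forall>i<KT. \<forall>n<N. cached \<pi> i n \<subseteq> file_packets (num_packets \<pi>) n \<and>
        real (card (cached \<pi> i n)) \<le> \<mu> * real (num_packets \<pi>)) \<and>
     (\<forall>d\<in>requests KR N.
        valid_fronthaul KT KR r (num_packets \<pi>) d (schedule_for \<pi> d) \<and>
        valid_edge KT KR nT N h (num_packets \<pi>) (cached \<pi>) d (schedule_for \<pi> d) \<and>
        all_delivered KR (num_packets \<pi>) d (schedule_for \<pi> d))"

text \<open>For \<open>r = 0\<close> the fronthaul term below is 0, since real division by 0 yields 0.\<close>

definition schedule_ndt :: "nat \<Rightarrow> real \<Rightarrow> nat \<Rightarrow> schedule \<Rightarrow> real" where
  "schedule_ndt KT r F s =
     (\<Sum>b<num_blocks s.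
        max (real (Max ((\<lambda>i. card (fronthaul s i b)) ` {..<KT})) / (real F * r)) (1 / real F))"

definition policy_ndt :: "nat \<Rightarrow> nat \<Rightarrow> nat \<Rightarrow> real \<Rightarrow> policy \<Rightarrow> real" where
  "policy_ndt KT KR N r \<pi> =
     Max ((\<lambda>d. schedule_ndt KT r (num_packets \<pi>) (schedule_for \<pi> d)) ` requests KR N)"

text \<open>The infimum over no policies is \<open>\<infinity>\<close>.\<close>

definition inf_pipelined_ndt ::
    "nat \<Rightarrow> nat \<Rightarrow> nat \<Rightarrow> nat \<Rightarrow> channels \<Rightarrow> real \<Rightarrow> real \<Rightarrow> ereal" where
  "inf_pipelined_ndt KT KR nT N h r \<mu> =
     (INF \<pi> \<in> {\<pi>. valid_policy KT KR nT N h r \<mu> \<pi>}. ereal (policy_ndt KT KR N r \<pi>))"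

text \<open>
  Convexity on a real interval for functions that may take infinite values, and the largest
  such function below a given one.
\<close>

definition ereal_convex_on :: "real set \<Rightarrow> (real \<Rightarrow> ereal) \<Rightarrow> bool" where
  "ereal_convex_on S g \<longleftrightarrow>
     (\<forall>x\<in>S. \<forall>y\<in>S. \<forall>t. 0 < t \<and> t < 1 \<longrightarrow>
        g ((1 - t) * x + t * y) \<le> ereal (1 - t) * g x + ereal t * g y)"

definition lower_convex_envelope :: "real set \<Rightarrow> (real \<Rightarrow> ereal) \<Rightarrow> real \<Rightarrow> ereal" where
  "lower_convex_envelope S f x =
     (SUP g \<in> {g. ereal_convex_on S g \<and> (\<forall>y\<in>S. g y \<le> f y)}. g x)"

definition min_pipelined_ndt ::
    "nat \<Rightarrow> nat \<Rightarrow> nat \<Rightarrow> nat \<Rightarrow> channels \<Rightarrow> real \<Rightarrow> real \<Rightarrow> ereal" where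
  "min_pipelined_ndt KT KR nT N h r \<mu> =
     lower_convex_envelope {0..1} (inf_pipelined_ndt KT KR nT N h r) \<mu>"

definition m_max :: "nat \<Rightarrow> nat \<Rightarrow> nat \<Rightarrow> nat" where
  "m_max KT KR nT = min KT (nat \<lceil>real KR / real nT\<rceil>)"

definition m_eq :: "nat \<Rightarrow> nat \<Rightarrow> real \<Rightarrow> real \<Rightarrow> real" where
  "m_eq KT nT r \<mu> =
     \<mu> * real KT / 2 +
     sqrt ((\<mu> * real KT * real nT)\<^sup>2 + 4 * real nT * real KT * r) / (2 * real nT)"

text \<open>
  At equality of the threshold both branches give \<open>m_max\<close>: it is then the nonnegative root
  of \<open>x\<^sup>2 - \<mu> KT x = KT r / nT\<close>, which is \<open>m_eq\<close>.
\<close>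

definition m_p_star :: "nat \<Rightarrow> nat \<Rightarrow> nat \<Rightarrow> real \<Rightarrow> real \<Rightarrow> real" where
  "m_p_star KT KR nT r \<mu> =
     (if \<mu> * real KT \<le> real (m_max KT KR nT) - real KT * r / (real (m_max KT KR nT) * real nT)
      then max (m_eq KT nT r \<mu>) 1
      else real (m_max KT KR nT))"

text \<open>
  The first quotient is a division of extended reals: for \<open>r = 0\<close> the numerator is positive in
  that branch, and the quotient is \<open>\<infinity>\<close>.
\<close>

definition pipelined_lower_bound :: "nat \<Rightarrow> nat \<Rightarrow> nat \<Rightarrow> real \<Rightarrow> real \<Rightarrow> ereal" where
  "pipelined_lower_bound KT KR nT r \<mu> =
     (if \<mu> * real KT < max (1 - real KT * r / real nT) 0
      then max (ereal (real KR * (1 - \<mu> * real KT)) / ereal (real KT * r)) 1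
      else ereal (max (real KR / (m_p_star KT KR nT r \<mu> * real nT)) 1))"

end

theory Submission
  imports Defs
begin

text \<open>
  Request pairwise distinct files. If \<open>m p\<close> ENs hold packet \<open>p\<close> when it is delivered, its block
  serves at most \<open>nT * m p\<close> users, so \<open>\<Sum>p. 1 / (nT * m p)\<close> is at most the number of blocks;
  the caches and the fronthaul, which carries at most \<open>F * r * T\<close> packets per EN within NDT \<open>T\<close>,
  bound \<open>\<Sum>p. m p\<close>. Every inequality \<open>u \<le> w * m + z / m\<close> valid for \<open>1 \<le> m \<le> KT\<close> thus
  gives a lower bound on \<open>T\<close> that is affine in \<open>\<mu>\<close>, and such a bound passes to the lower convex
  envelope. The claim at a given \<open>\<mu>\<close> needs \<open>1 \<le> m\<close>, \<open>1 \<le> KT / m\<close>, the tangent inequality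
  \<open>2 * a \<le> m + a\<^sup>2 / m\<close> at \<open>a = m_eq\<close>, and \<open>T \<ge> 1\<close>, which holds as a user receives at most one
  packet per block.
\<close>

section \<open>Zero forcing: linear algebra of nondegenerate channels\<close>

text \<open>An invertible matrix has trivial kernel. The form with sums over \<open>J\<close> spares
  later arguments the renumbering of rows and columns by \<open>pick\<close>.\<close>

lemma submatrix_invertible_kernel:
  fixes A :: "'a::comm_ring_1 mat"
  assumes inv: "invertible_mat (submatrix A I J)"
    and A: "A \<in> carrier_mat m n" and I: "I \<subseteq> {..<m}" and J: "J \<subseteq> {..<n}"
    and zero: "\<And>i. i \<in> I \<Longrightarrow> (\<Sum>j\<in>J. A $$ (i, j) * x j) = 0"
    and "j \<in> J"
  shows "x j = 0"
proof -
  let ?M = "submatrix A I J" and ?w = "vec (card J) (\<lambda>l. x (pick J l))"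
  have finI: "finite I" and finJ: "finite J"
    using I J finite_subset by auto
  have eqI: "{i. i < dim_row A \<and> i \<in> I} = I" and eqJ: "{j. j < dim_col A \<and> j \<in> J} = J"
    using A I J by auto
  have M: "?M \<in> carrier_mat (card I) (card J)"
    by (intro carrier_matI) (simp_all add: dim_submatrix eqI eqJ)
  \<comment> \<open>\<open>pick J\<close> enumerates \<open>J\<close> increasingly, so its inverse
    sends \<open>c\<close> to the number of elements of \<open>J\<close> below
    \<open>c\<close>.\<close>
  have reindex: "(\<Sum>l<card J. f (pick J l)) = sum f J" for f :: "nat \<Rightarrow> 'a"
  proof (rule sum.reindex_bij_witness[where i = "\<lambda>c. card {a\<in>J. a < c}" and j = "pick J"])
    fix c assume c: "c \<in> J"
    have "{a\<in>J. a < c} \<subset> J" using c by auto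
    then show "card {a\<in>J. a < c} \<in> {..<card J}"
      using psubset_card_mono[OF finJ] by simp
  qed (simp_all add: pick_card_in_set card_pick_le pick_in_set_le)
  have Mw: "?M *\<^sub>v ?w = 0\<^sub>v (card I)"
  proof (rule eq_vecI)
    fix l assume "l < dim_vec (0\<^sub>v (card I) :: 'a vec)"
    then have l: "l < card I" by simp
    have "(?M *\<^sub>v ?w) $ l = (\<Sum>q<card J. ?M $$ (l, q) * x (pick J q))"
      using l M by (auto simp: scalar_prod_def atLeast0LessThan intro!: sum.cong)
    also have "\<dots> = (\<Sum>q<card J. A $$ (pick I l, pick J q) * x (pick J q))"
      using l by (auto simp: submatrix_index eqI eqJ)
    also have "\<dots> = (\<Sum>j\<in>J. A $$ (pick I l, j) * x j)"
      by (rule reindex)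
    also have "\<dots> = 0"
      by (rule zero) (use l pick_in_set_le in auto)
    finally show "(?M *\<^sub>v ?w) $ l = 0\<^sub>v (card I) $ l" using l by simp
  qed (use M in auto)
  obtain B where B: "?M * B = 1\<^sub>m (dim_row ?M)" "B * ?M = 1\<^sub>m (dim_row B)"
    using inv unfolding invertible_mat_def inverts_mat_def by auto
  \<comment> \<open>\<open>inverts_mat\<close> leaves the shape of \<open>B\<close> open; each of
    the two identity equations fixes one dimension.\<close>
  have Bc: "B \<in> carrier_mat (card J) (card I)"
  proof
    show "dim_col B = card I"
      using arg_cong[OF B(1), of dim_col] M by simp
    show "dim_row B = card J"
      using arg_cong[OF B(2), of dim_col] M by simp
  qed
  have "B *\<^sub>v (?M *\<^sub>v ?w) = 0\<^sub>v (card J)"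
    unfolding Mw using Bc by auto
  moreover have "B *\<^sub>v (?M *\<^sub>v ?w) = ?w"
    using B(2) Bc M by (subst assoc_mult_mat_vec[symmetric]) auto
  ultimately have w0: "?w = 0\<^sub>v (card J)" by simp
  have "{a\<in>J. a < j} \<subset> J" using \<open>j \<in> J\<close> by auto
  then have "card {a\<in>J. a < j} < card J"
    using psubset_card_mono[OF finJ] by simp
  then have "x (pick J (card {a\<in>J. a < j})) = 0"
    using arg_cong[OF w0, of "\<lambda>v. v $ card {a\<in>J. a < j}"] by simp
  then show ?thesis using pick_card_in_set[OF \<open>j \<in> J\<close>] by simp
qed

text \<open>Column \<open>c\<close> of \<open>channel_matrix\<close> is antenna
  \<open>c mod n\<close> of EN \<open>c div n\<close>, so the ENs in \<open>S\<close> own disjoint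
  intervals of \<open>n\<close> columns each.\<close>

lemma card_antennas:
  assumes "S \<subseteq> {..<K}"
  shows "card {c. c < K * n \<and> c div n \<in> S} = n * card S"
proof -
  have fin: "finite S" using assms finite_subset by auto
  have "{c. c < K * n \<and> c div n \<in> S} = (\<Union>i\<in>S. {i * n..<i * n + n})" (is "?L = ?R")
  proof (intro equalityI subsetI)
    fix c assume "c \<in> ?L"
    then have c: "c < K * n" "c div n \<in> S" by auto
    then have "n > 0" by (cases n) auto
    then have "c mod n < n" by simp
    moreover have "c = c div n * n + c mod n" by simp
    ultimately have "c \<in> {c div n * n..<c div n * n + n}" by (metis atLeastLessThan_iff le_add1 nat_add_left_cancel_less)
    with c(2) show "c \<in> ?R" by blast
  next
    fix c assume "c \<in> ?R"
    then obtain i where i: "i \<in> S" "i * n \<le> c" "c < i * n + n" by auto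
    have "Suc i * n \<le> K * n" using i(1) assms by (intro mult_right_mono) auto
    then have "c < K * n" using i(3) by simp
    moreover have "c div n = i" using i by (intro div_nat_eqI) (auto simp: algebra_simps)
    ultimately show "c \<in> ?L" using i(1) by simp
  qed
  moreover have "disjoint_family_on (\<lambda>i. {i * n..<i * n + n}) S"
  proof -
    have "{i * n..<i * n + n} \<inter> {j * n..<j * n + n} = {}" if "i < j" for i j
    proof -
      have "Suc i * n \<le> j * n" using that by (intro mult_right_mono) auto
      then show ?thesis by auto
    qed
    then show ?thesis unfolding disjoint_family_on_def
      by (metis inf_commute linorder_neqE_nat)
  qed
  ultimately show ?thesis
    using fin by (simp add: card_UN_disjoint disjoint_family_on_def)
qed

text \<open>Zero forcing: the \<open>nT * card S\<close> antennas of the ENs in \<open>S\<close> can null at most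
  \<open>nT * card S - 1\<close> channels without nulling the stream itself.\<close>

lemma served_le_antennas:
  assumes nd: "nondegenerate_channels KT KR nT h"
    and R: "R \<subseteq> {..<KR}" and k: "k \<in> R" and S: "S \<subseteq> {..<KT}"
    and v: "\<And>i. i < KT \<Longrightarrow> v i \<in> carrier_vec nT"
    and silent: "\<And>i. i < KT \<Longrightarrow> i \<notin> S \<Longrightarrow> v i = 0\<^sub>v nT"
    and useful: "(\<Sum>i<KT. h b k i \<bullet> v i) \<noteq> 0"
    and nulled: "\<And>k'. k' \<in> R - {k} \<Longrightarrow> (\<Sum>i<KT. h b k' i \<bullet> v i) = 0"
  shows "card R \<le> nT * card S"
proof (rule ccontr)
  assume "\<not> card R \<le> nT * card S"
  moreover have "finite R" using R finite_subset by auto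
  ultimately have "nT * card S \<le> card (R - {k})" using k by simp
  \<comment> \<open>Exactly as many nulled users as active antennas are kept, to get a square
    system.\<close>
  then obtain I where I: "I \<subseteq> R - {k}" "card I = nT * card S"
    by (meson obtain_subset_with_card_n)
  define J where "J = {c. c < KT * nT \<and> c div nT \<in> S}"
  \<comment> \<open>The precoders of all ENs, concatenated in the column order of
    \<open>channel_matrix\<close>.\<close>
  define x where "x c = v (c div nT) $ (c mod nT)" for c
  let ?H = "channel_matrix KT KR nT h b"
  have J: "J \<subseteq> {..<KT * nT}" "card J = nT * card S"
    using card_antennas[OF S] by (auto simp: J_def)
  have I': "I \<subseteq> {..<KR}" using I R by auto
  have x0: "x c = 0" if "c < KT * nT" "c \<notin> J" for c
  proof -
    have "nT > 0" using that(1) by (cases nT) auto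
    moreover have "c div nT < KT" using that(1) by (simp add: less_mult_imp_div_less)
    moreover have "c div nT \<notin> S" using that by (simp add: J_def)
    ultimately show ?thesis by (simp add: x_def silent)
  qed
  have rows: "(\<Sum>i<KT. h b k' i \<bullet> v i) = (\<Sum>c\<in>J. ?H $$ (k', c) * x c)" if "k' < KR" for k'
  proof -
    have "(\<Sum>i<KT. h b k' i \<bullet> v i)
      = (\<Sum>i<KT. \<Sum>c\<in>{i * nT..<i * nT + nT}. ?H $$ (k', c) * x c)"
    proof (rule sum.cong[OF refl])
      fix i assume "i \<in> {..<KT}"
      then have i: "i < KT" by simp
      have bd: "i * nT + a < KT * nT" if "a < nT" for a
      proof -
        have "Suc i * nT \<le> KT * nT" using i by (intro mult_right_mono) auto
        then show ?thesis using that by simp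
      qed
      have "(\<Sum>c\<in>{i * nT..<i * nT + nT}. ?H $$ (k', c) * x c)
        = (\<Sum>a\<in>{0..<nT}. ?H $$ (k', a + i * nT) * x (a + i * nT))"
        using sum.shift_bounds_nat_ivl[of "\<lambda>c. ?H $$ (k', c) * x c" 0 "i * nT" nT]
        by (simp add: add.commute)
      also have "\<dots> = (\<Sum>a\<in>{0..<nT}. h b k' i $ a * v i $ a)"
        using bd that by (intro sum.cong) (auto simp: channel_matrix_def x_def add.commute)
      finally show "h b k' i \<bullet> v i = (\<Sum>c\<in>{i * nT..<i * nT + nT}. ?H $$ (k', c) * x c)"
        using v[OF i] by (simp add: scalar_prod_def)
    qed
    also have "\<dots> = (\<Sum>c<KT * nT. ?H $$ (k', c) * x c)"
      by (rule sum.nat_group)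
    also have "\<dots> = (\<Sum>c\<in>J. ?H $$ (k', c) * x c)"
      using J(1) x0 by (intro sum.mono_neutral_right) auto
    finally show ?thesis .
  qed
  \<comment> \<open>Nulling at \<open>I\<close> forces all active coefficients to vanish, and with
    them the stream at user \<open>k\<close>.\<close>
  have "invertible_mat (submatrix ?H I J)"
    using nd I' J I(2) unfolding nondegenerate_channels_def by simp
  moreover have "?H \<in> carrier_mat KR (KT * nT)"
    by (simp add: channel_matrix_def)
  moreover have "(\<Sum>c\<in>J. ?H $$ (i, c) * x c) = 0" if "i \<in> I" for i
  proof -
    have "i < KR" "i \<in> R - {k}" using that I I' by auto
    then show ?thesis using rows[of i] nulled[of i] by metis
  qed
  ultimately have "x c = 0" if "c \<in> J" for c
    using submatrix_invertible_kernel I' J(1) that by blast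
  then have "(\<Sum>i<KT. h b k i \<bullet> v i) = 0"
    using rows[of k] k R by (auto simp: subset_iff)
  with useful show False by contradiction
qed

section \<open>Counting blocks, fronthaul load and copies of packets\<close>

text \<open>Each term is at most the reciprocal of the number of elements sharing its block, so
  every block contributes at most 1.\<close>

lemma sum_inverse_le_num_blocks:
  fixes m :: "'a \<Rightarrow> nat"
  assumes fin: "finite X" and \<beta>: "\<And>x. x \<in> X \<Longrightarrow> \<beta> x < (B::nat)"
    and block: "\<And>x. x \<in> X \<Longrightarrow> card {y\<in>X. \<beta> y = \<beta> x} \<le> m x"
  shows "(\<Sum>x\<in>X. 1 / real (m x)) \<le> real B"
proof -
  have "(\<Sum>x\<in>X. 1 / real (m x)) = (\<Sum>b<B. \<Sum>x\<in>{x\<in>X. \<beta> x = b}. 1 / real (m x))"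
    by (rule sum.group[symmetric]) (use fin \<beta> in auto)
  also have "\<dots> \<le> (\<Sum>b<B. 1)"
  proof (rule sum_mono)
    fix b
    let ?X = "{x\<in>X. \<beta> x = b}"
    have "(\<Sum>x\<in>?X. 1 / real (m x)) \<le> (\<Sum>x\<in>?X. 1 / real (card ?X))"
    proof (rule sum_mono)
      fix x assume x: "x \<in> ?X"
      then have "card ?X > 0" using fin by (auto simp: card_gt_0_iff)
      moreover have "card ?X \<le> m x" using x block[of x] by auto
      ultimately show "1 / real (m x) \<le> 1 / real (card ?X)"
        by (intro divide_left_mono) auto
    qed
    \<comment> \<open>The sum is 1, or 0 for an empty block.\<close>
    also have "\<dots> \<le> 1" by simp
    finally show "(\<Sum>x\<in>?X. 1 / real (m x)) \<le> 1" .
  qed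
  finally show ?thesis by simp
qed

text \<open>A block lasts at least as long as the fronthaul transfer to its most loaded EN.\<close>

lemma fronthaul_le_schedule_ndt:
  assumes fh: "valid_fronthaul KT KR r F d s" and F: "F \<ge> 1" and r: "0 \<le> r" and i: "i < KT"
  shows "(\<Sum>b<num_blocks s. real (card (fronthaul s i b))) \<le> real F * r * schedule_ndt KT r F s"
  unfolding schedule_ndt_def sum_distrib_left
proof (rule sum_mono)
  fix b assume b: "b \<in> {..<num_blocks s}"
  let ?M = "Max ((\<lambda>i. card (fronthaul s i b)) ` {..<KT})"
  show "real (card (fronthaul s i b)) \<le> real F * r * max (real ?M / (real F * r)) (1 / real F)"
  proof (cases "r = 0")
    \<comment> \<open>Division by 0 makes the fronthaul term 0 here; the bound holds because nothing
      is sent.\<close>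
    case True
    then show ?thesis using fh b i by (auto simp: valid_fronthaul_def)
  next
    case False
    with r F have pos: "real F * r > 0" by simp
    have "card (fronthaul s i b) \<le> ?M" using i by (intro Max_ge) auto
    then have "real (card (fronthaul s i b)) \<le> real F * r * (real ?M / (real F * r))"
      using pos by auto
    also have "\<dots> \<le> real F * r * max (real ?M / (real F * r)) (1 / real F)"
      using pos by (intro mult_left_mono) auto
    finally show ?thesis .
  qed
qed

lemma num_blocks_le_schedule_ndt:
  assumes "F \<ge> 1"
  shows "real (num_blocks s) \<le> real F * schedule_ndt KT r F s"
proof -
  have "(\<Sum>b<num_blocks s. 1 / real F) \<le> schedule_ndt KT r F s"
    unfolding schedule_ndt_def by (intro sum_mono) simp
  then show ?thesis using assms by (simp add: field_simps)
qed

text \<open>One packet per user and block: the blocks map onto the packets of the requested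
  file.\<close>

lemma num_packets_le_num_blocks:
  assumes del: "all_delivered KR F d s" and "k < KR"
  shows "F \<le> num_blocks s"
proof -
  have "file_packets F (d k) \<subseteq> (\<lambda>b. sent_packet s b k) ` {..<num_blocks s}"
  proof
    fix p assume "p \<in> file_packets F (d k)"
    then obtain b where "b < num_blocks s" "sent_packet s b k = p"
      using assms unfolding all_delivered_def by blast
    then show "p \<in> (\<lambda>b. sent_packet s b k) ` {..<num_blocks s}" by auto
  qed
  then have "card (file_packets F (d k)) \<le> card {..<num_blocks s}"
    by (rule surj_card_le[rotated]) simp
  then show ?thesis by (simp add: file_packets_def)
qed

text \<open>For the request of pairwise distinct files, \<open>m p\<close> is the number of ENs holding packet
  \<open>p\<close> in the block in which its user receives it.\<close>

lemma delivery_multiplicities: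
  assumes N: "KR \<le> N" and r: "0 \<le> r" and F: "F \<ge> 1"
    and nd: "nondegenerate_channels KT KR nT h"
    and C: "\<And>i n. i < KT \<Longrightarrow> n < N \<Longrightarrow> C i n \<subseteq> file_packets F n"
    and Csize: "\<And>i n. i < KT \<Longrightarrow> n < N \<Longrightarrow> real (card (C i n)) \<le> \<mu> * real F"
    and d: "\<And>k. k < KR \<Longrightarrow> d k = k"
    and fh: "valid_fronthaul KT KR r F d s" and edge: "valid_edge KT KR nT N h F C d s"
    and del: "all_delivered KR F d s"
  obtains m :: "packet \<Rightarrow> nat" where
    "\<And>p. p \<in> {..<KR} \<times> {..<F} \<Longrightarrow> 1 \<le> m p"
    "\<And>p. p \<in> {..<KR} \<times> {..<F} \<Longrightarrow> m p \<le> KT"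
    "(\<Sum>p\<in>{..<KR} \<times> {..<F}. 1 / real (nT * m p)) \<le> real (num_blocks s)"
    "(\<Sum>p\<in>{..<KR} \<times> {..<F}. real (m p))
      \<le> real F * (real KR * \<mu> * real KT + real KT * r * schedule_ndt KT r F s)"
proof -
  \<comment> \<open>As \<open>d k = k\<close>, the first component of a packet in \<open>?X\<close>
    is also the user who wants it.\<close>
  let ?X = "{..<KR} \<times> {..<F}" and ?B = "num_blocks s" and ?T = "schedule_ndt KT r F s"
  have "\<forall>p\<in>?X. \<exists>b. b < ?B \<and> fst p \<in> served s b \<and> sent_packet s b (fst p) = p"
    using del d unfolding all_delivered_def file_packets_def by force
  then obtain \<beta> where \<beta>: "\<And>p. p \<in> ?X \<Longrightarrow>
      \<beta> p < ?B \<and> fst p \<in> served s (\<beta> p) \<and> sent_packet s (\<beta> p) (fst p) = p"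
    by metis
  define m where "m p = card {i. i < KT \<and> p \<in> available N C s i (\<beta> p)}" for p
  have block: "card {q\<in>?X. \<beta> q = \<beta> p} \<le> nT * m p" if p: "p \<in> ?X" for p
  proof -
    let ?b = "\<beta> p" and ?k = "fst p"
    have b: "?b < ?B" and k: "?k \<in> served s ?b" and sent: "sent_packet s ?b ?k = p"
      using \<beta>[OF p] by auto
    have R: "served s ?b \<subseteq> {..<KR}" using edge b by (auto simp: valid_edge_def)
    \<comment> \<open>A user gets one packet per block, so packets delivered in the same block go to
      distinct users.\<close>
    have inj: "inj_on fst {q\<in>?X. \<beta> q = ?b}"
    proof (rule inj_onI)
      fix q q' assume "q \<in> {q\<in>?X. \<beta> q = ?b}" "q' \<in> {q\<in>?X. \<beta> q = ?b}" "fst q = fst q'"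
      then show "q = q'" using \<beta>[of q] \<beta>[of q'] by auto
    qed
    have "card {q\<in>?X. \<beta> q = ?b} = card (fst ` {q\<in>?X. \<beta> q = ?b})"
      by (rule card_image[OF inj, symmetric])
    also have "\<dots> \<le> card (served s ?b)"
    proof (rule card_mono)
      show "finite (served s ?b)" using R finite_subset by auto
      show "fst ` {q\<in>?X. \<beta> q = ?b} \<subseteq> served s ?b"
      proof
        fix k assume "k \<in> fst ` {q\<in>?X. \<beta> q = ?b}"
        then obtain q where "q \<in> ?X" "\<beta> q = ?b" "k = fst q" by auto
        then show "k \<in> served s ?b" using \<beta>[of q] by metis
      qed
    qed
    also have "\<dots> \<le> nT * m p"
      unfolding m_def
    proof (rule served_le_antennas[OF nd R k])
      have E: "(\<forall>i<KT. precoder s ?b i ?k \<in> carrier_vec nT \<and>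
            (sent_packet s ?b ?k \<notin> available N C s i ?b \<longrightarrow> precoder s ?b i ?k = 0\<^sub>v nT)) \<and>
          (\<Sum>i<KT. h ?b ?k i \<bullet> precoder s ?b i ?k) \<noteq> 0 \<and>
          (\<forall>k'\<in>served s ?b - {?k}. (\<Sum>i<KT. h ?b k' i \<bullet> precoder s ?b i ?k) = 0)"
        using edge b k unfolding valid_edge_def by blast
      show "(\<Sum>i<KT. h ?b ?k i \<bullet> precoder s ?b i ?k) \<noteq> 0" using E by blast
      show "precoder s ?b i ?k \<in> carrier_vec nT" if "i < KT" for i using E that by blast
      show "precoder s ?b i ?k = 0\<^sub>v nT"
        if "i < KT" "i \<notin> {i. i < KT \<and> p \<in> available N C s i ?b}" for i
        using E that sent by auto
      show "(\<Sum>i<KT. h ?b k' i \<bullet> precoder s ?b i ?k) = 0" if "k' \<in> served s ?b - {?k}" for k'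
        using E that by blast
    qed auto
    finally show ?thesis .
  qed
  have m1: "1 \<le> m p" if p: "p \<in> ?X" for p
  proof -
    have "0 < card {q\<in>?X. \<beta> q = \<beta> p}" using p by (auto simp: card_gt_0_iff)
    then have "0 < nT * m p" using block[OF p] by linarith
    then show ?thesis by simp
  qed
  have mKT: "m p \<le> KT" for p
  proof -
    have "m p \<le> card {..<KT}" unfolding m_def by (intro card_mono) auto
    then show ?thesis by simp
  qed
  have blocks: "(\<Sum>p\<in>?X. 1 / real (nT * m p)) \<le> real ?B"
    by (rule sum_inverse_le_num_blocks[where \<beta> = \<beta>]) (use \<beta> block in auto)
  have per_EN: "real (card {p\<in>?X. p \<in> available N C s i (\<beta> p)})
      \<le> real KR * \<mu> * real F + real F * r * ?T" if i: "i < KT" for i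
  proof -
    have finC: "finite (C i n)" if "n < N" for n
      using C[OF i that] by (rule finite_subset) (simp add: file_packets_def)
    have finf: "finite (fronthaul s i b)" if "b < ?B" for b
    proof -
      have "fronthaul s i b \<subseteq> (\<Union>k<KR. file_packets F (d k))"
        using fh i that by (auto simp: valid_fronthaul_def)
      then show ?thesis by (rule finite_subset) (simp add: file_packets_def)
    qed
    \<comment> \<open>Only the caches of the \<open>KR\<close> requested files matter, although
      \<open>available\<close> ranges over all \<open>N\<close> files.\<close>
    have "{p\<in>?X. p \<in> available N C s i (\<beta> p)}
      \<subseteq> (\<Union>n<KR. C i n) \<union> (\<Union>b<?B. fronthaul s i b)" (is "_ \<subseteq> ?U")
    proof
      fix p assume "p \<in> {p\<in>?X. p \<in> available N C s i (\<beta> p)}"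
      then have p: "p \<in> ?X" "p \<in> available N C s i (\<beta> p)" by auto
      from p(2) consider n where "n < N" "p \<in> C i n" | b where "b < \<beta> p" "p \<in> fronthaul s i b"
        unfolding available_def by auto
      then show "p \<in> ?U"
      proof cases
        case 1
        then have "fst p = n" using C[OF i, of n] by (auto simp: file_packets_def)
        then show ?thesis using 1 p(1) by auto
      next
        case 2
        then have "b < ?B" using \<beta>[OF p(1)] by simp
        then show ?thesis using 2 by auto
      qed
    qed
    then have "card {p\<in>?X. p \<in> available N C s i (\<beta> p)} \<le> card ?U"
      using finC finf N by (intro card_mono) auto
    also have "\<dots> \<le> card (\<Union>n<KR. C i n) + card (\<Union>b<?B. fronthaul s i b)"
      by (rule card_Un_le)
    also have "\<dots> \<le> (\<Sum>n<KR. card (C i n)) + (\<Sum>b<?B. card (fronthaul s i b))"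
      by (intro add_mono card_UN_le) auto
    finally have "real (card {p\<in>?X. p \<in> available N C s i (\<beta> p)})
      \<le> (\<Sum>n<KR. real (card (C i n))) + (\<Sum>b<?B. real (card (fronthaul s i b)))"
      by (simp flip: of_nat_sum of_nat_add)
    also have "\<dots> \<le> (\<Sum>n<KR. \<mu> * real F) + real F * r * ?T"
      using Csize[OF i] N fronthaul_le_schedule_ndt[OF fh F r i]
      by (intro add_mono sum_mono) auto
    finally show ?thesis by (simp add: mult_ac)
  qed
  \<comment> \<open>Double counting of the pairs of a packet and an EN holding it at
    delivery.\<close>
  have "(\<Sum>p\<in>?X. m p) = (\<Sum>p\<in>?X. \<Sum>i | i \<in> {..<KT} \<and> p \<in> available N C s i (\<beta> p). 1)"
    by (simp add: m_def)
  also have "\<dots> = (\<Sum>i<KT. \<Sum>p | p \<in> ?X \<and> p \<in> available N C s i (\<beta> p). 1)"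
    by (rule sum.swap_restrict) auto
  finally have "(\<Sum>p\<in>?X. real (m p))
      = (\<Sum>i<KT. real (card {p\<in>?X. p \<in> available N C s i (\<beta> p)}))"
    by (simp flip: of_nat_sum)
  also have "\<dots> \<le> (\<Sum>i<KT. real KR * \<mu> * real F + real F * r * ?T)"
    using per_EN by (intro sum_mono) auto
  also have "\<dots> = real F * (real KR * \<mu> * real KT + real KT * r * ?T)"
    by (simp add: algebra_simps)
  finally show thesis
    using that[of m] m1 mKT blocks by blast
qed

section \<open>Bounds on the NDT of a single policy\<close>

lemma schedule_ndt_le_policy_ndt:
  assumes "d \<in> requests KR N"
  shows "schedule_ndt KT r (num_packets \<pi>) (schedule_for \<pi> d) \<le> policy_ndt KT KR N r \<pi>"
  unfolding policy_ndt_def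
  by (rule Max_ge) (use assms in \<open>auto simp: requests_def intro: finite_PiE\<close>)

text \<open>For fixed \<open>a\<close> all four bounds are affine in \<open>\<mu>\<close>. The
  parameter \<open>a\<close> is free, so it can be tuned to one cache size and the bound still used
  at all others.\<close>

lemma policy_ndt_bounds:
  assumes KR: "KR \<ge> 1" and nT: "nT \<ge> 1" and N: "KR \<le> N" and r: "0 \<le> r"
    and nd: "nondegenerate_channels KT KR nT h"
    and \<pi>: "valid_policy KT KR nT N h r \<mu> \<pi>"
  defines "T \<equiv> policy_ndt KT KR N r \<pi>"
  shows "1 \<le> T"
    and "real KR \<le> real nT * real KT * T"
    and "real KR * (1 - \<mu> * real KT) \<le> real KT * r * T"
    and "real KR * (2 * a - \<mu> * real KT) \<le> (real nT * a\<^sup>2 + real KT * r) * T"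
proof -
  define d where "d = restrict id {..<KR}"
  define F s t where "F = num_packets \<pi>" and "s = schedule_for \<pi> d" and "t = schedule_ndt KT r F s"
  have d: "d \<in> requests KR N" using N by (auto simp: requests_def d_def)
  have F: "F \<ge> 1" using \<pi> by (simp add: valid_policy_def F_def)
  have tT: "t \<le> T"
    unfolding t_def T_def F_def s_def by (rule schedule_ndt_le_policy_ndt[OF d])
  have del: "all_delivered KR F d s"
    using \<pi> d by (simp add: valid_policy_def F_def s_def)
  obtain m :: "packet \<Rightarrow> nat" where
    m1: "\<And>p. p \<in> {..<KR} \<times> {..<F} \<Longrightarrow> 1 \<le> m p" and
    mKT: "\<And>p. p \<in> {..<KR} \<times> {..<F} \<Longrightarrow> m p \<le> KT" and
    blocks: "(\<Sum>p\<in>{..<KR} \<times> {..<F}. 1 / real (nT * m p)) \<le> real (num_blocks s)" and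
    total: "(\<Sum>p\<in>{..<KR} \<times> {..<F}. real (m p))
      \<le> real F * (real KR * \<mu> * real KT + real KT * r * t)"
    unfolding t_def
  proof (rule delivery_multiplicities[OF N r F nd, of "cached \<pi>" \<mu> d s])
    show "d k = k" if "k < KR" for k using that by (simp add: d_def)
  qed (use \<pi> d in \<open>auto simp: valid_policy_def F_def s_def\<close>)
  let ?X = "{..<KR} \<times> {..<F}"
  have B: "real (num_blocks s) \<le> real F * t"
    unfolding t_def by (rule num_blocks_le_schedule_ndt[OF F])
  have "F \<le> num_blocks s" by (rule num_packets_le_num_blocks[OF del, of 0]) (use KR in simp)
  then have "real F * 1 \<le> real F * t" using B by linarith
  then have t1: "1 \<le> t" using F by (simp add: mult_le_cancel_left)
  then show "1 \<le> T" using tT by simp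
  have inv_blocks: "(\<Sum>p\<in>?X. 1 / real (m p)) \<le> real F * (real nT * t)"
  proof -
    have "(\<Sum>p\<in>?X. 1 / real (m p)) = real nT * (\<Sum>p\<in>?X. 1 / real (nT * m p))"
      using nT by (simp add: sum_distrib_left)
    also have "\<dots> \<le> real nT * (real F * t)"
      using blocks B by (intro mult_left_mono) auto
    finally show ?thesis by (simp add: mult_ac)
  qed
  \<comment> \<open>The inequality for \<open>u\<close> is summed over all packets at
    \<open>x = m p\<close>; \<open>total\<close> and \<open>inv_blocks\<close> bound the two
    resulting sums.\<close>
  have affine: "u * real KR
      \<le> w * (real KR * \<mu> * real KT + real KT * r * T) + z * (real nT * T)"
    if wz: "w \<ge> 0" "z \<ge> 0" and u: "\<And>x. 1 \<le> x \<Longrightarrow> x \<le> real KT \<Longrightarrow> u \<le> w * x + z * (1 / x)"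
    for u w z
  proof -
    have "real F * (u * real KR) = (\<Sum>p\<in>?X. u)"
      by (simp add: card_cartesian_product)
    also have "\<dots> \<le> (\<Sum>p\<in>?X. w * real (m p) + z * (1 / real (m p)))"
    proof (rule sum_mono)
      fix p assume p: "p \<in> ?X"
      have "1 \<le> real (m p)" "real (m p) \<le> real KT" using m1[OF p] mKT[OF p] by simp_all
      then show "u \<le> w * real (m p) + z * (1 / real (m p))" by (rule u)
    qed
    also have "\<dots> = w * (\<Sum>p\<in>?X. real (m p)) + z * (\<Sum>p\<in>?X. 1 / real (m p))"
      by (simp add: sum.distrib sum_distrib_left)
    also have "\<dots> \<le> w * (real F * (real KR * \<mu> * real KT + real KT * r * t))
        + z * (real F * (real nT * t))"
      using wz total inv_blocks by (intro add_mono mult_left_mono) auto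
    also have "\<dots> \<le> w * (real F * (real KR * \<mu> * real KT + real KT * r * T))
        + z * (real F * (real nT * T))"
      by (rule add_mono; intro mult_left_mono add_left_mono) (use wz tT r in auto)
    also have "\<dots> = real F *
        (w * (real KR * \<mu> * real KT + real KT * r * T) + z * (real nT * T))"
      by (simp add: algebra_simps)
    finally show ?thesis using F by (simp add: mult_le_cancel_left)
  qed
  \<comment> \<open>\<open>affine\<close> takes its parameters in the order \<open>w\<close>,
    \<open>z\<close>, \<open>u\<close>: here \<open>1 \<le> KT / x\<close>, next
    \<open>1 \<le> x\<close>, last the tangent inequality.\<close>
  show "real KR \<le> real nT * real KT * T"
    using affine[of 0 "real KT" 1] by (simp add: mult_ac)
  show "real KR * (1 - \<mu> * real KT) \<le> real KT * r * T"
    using affine[of 1 0 1] by (simp add: algebra_simps)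
  have "2 * a \<le> 1 * x + a\<^sup>2 * (1 / x)" if "1 \<le> x" for x
  proof -
    have "x + a\<^sup>2 / x - 2 * a = (x - a)\<^sup>2 / x"
      using that by (simp add: field_simps power2_eq_square)
    also have "\<dots> \<ge> 0" using that by simp
    finally show ?thesis by simp
  qed
  then show "real KR * (2 * a - \<mu> * real KT) \<le> (real nT * a\<^sup>2 + real KT * r) * T"
    using affine[of 1 "a\<^sup>2" "2 * a"] by (simp add: algebra_simps)
qed

section \<open>Passing affine bounds to the lower convex envelope\<close>

text \<open>An affine minorant is convex, hence one of the competitors in the supremum.\<close>

lemma affine_le_lower_convex_envelope:
  assumes "\<And>y. y \<in> S \<Longrightarrow> ereal (p + q * y) \<le> f y"
  shows "ereal (p + q * x) \<le> lower_convex_envelope S f x"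
  unfolding lower_convex_envelope_def
proof (rule SUP_upper)
  have "p + q * ((1 - t) * u + t * v) = (1 - t) * (p + q * u) + t * (p + q * v)" for t u v :: real
    by (simp add: algebra_simps)
  then show "(\<lambda>y. ereal (p + q * y)) \<in> {g. ereal_convex_on S g \<and> (\<forall>y\<in>S. g y \<le> f y)}"
    using assms by (simp add: ereal_convex_on_def)
qed

text \<open>The envelope at \<open>x\<close> depends on other cache sizes too, so the bound is
  required for policies of every cache size \<open>y\<close>.\<close>

lemma affine_le_min_pipelined_ndt:
  assumes "\<And>y \<pi>. valid_policy KT KR nT N h r y \<pi> \<Longrightarrow> p + q * y \<le> policy_ndt KT KR N r \<pi>"
  shows "ereal (p + q * x) \<le> min_pipelined_ndt KT KR nT N h r x"
  unfolding min_pipelined_ndt_def inf_pipelined_ndt_def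
  by (intro affine_le_lower_convex_envelope INF_greatest) (use assms in auto)

section \<open>Evaluating the affine bounds at a given cache size\<close>

text \<open>For a positive root \<open>m\<close> the equation is a balance: if every packet has
  multiplicity \<open>m\<close> and \<open>T = KR / (nT * m)\<close>, then caches and fronthaul
  supply exactly \<open>KR * m\<close> copies per packet index.\<close>

lemma m_eq_root:
  assumes "nT \<ge> 1" and "0 \<le> r"
  shows "(m_eq KT nT r \<mu>)\<^sup>2 = \<mu> * real KT * m_eq KT nT r \<mu> + real KT * r / real nT"
proof -
  let ?q = "sqrt ((\<mu> * real KT * real nT)\<^sup>2 + 4 * real nT * real KT * r)"
  have n: "real nT > 0" using assms by simp
  have m: "m_eq KT nT r \<mu> = (\<mu> * real KT * real nT + ?q) / (2 * real nT)"
    using n by (simp add: m_eq_def field_simps)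
  have "?q\<^sup>2 = (\<mu> * real KT * real nT)\<^sup>2 + 4 * real nT * real KT * r"
    using assms by simp
  then show ?thesis
    unfolding m using n by (simp add: field_simps power2_eq_square)
qed

theorem proposition8:
  fixes KT KR nT N :: nat and r \<mu> :: real and h :: channels
  assumes "KT \<ge> 1" and "KR \<ge> 1" and "nT \<ge> 1" and "N \<ge> KR"
    and "0 \<le> \<mu>" and "\<mu> \<le> 1" and "0 \<le> r"
    and "nondegenerate_channels KT KR nT h"
  shows "min_pipelined_ndt KT KR nT N h r \<mu> \<ge> pipelined_lower_bound KT KR nT r \<mu>"
proof -
  let ?\<delta> = "min_pipelined_ndt KT KR nT N h r \<mu>" and ?a = "m_eq KT nT r \<mu>"
    and ?M = "real (m_max KT KR nT)"
  note bounds = policy_ndt_bounds[OF assms(2,3,4,7,8)]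
  note affine = affine_le_min_pipelined_ndt[of KT KR nT N h r]
  have K: "real KT > 0" "real KR > 0" "real nT > 0" using assms(1-3) by auto
  have one: "1 \<le> ?\<delta>"
    using affine[of 1 0 \<mu>] bounds(1) by (simp flip: one_ereal_def)
  \<comment> \<open>This comes from \<open>1 \<le> KT / m\<close> and serves the case
    \<open>m_max = KT\<close>.\<close>
  have const: "ereal (real KR / (real KT * real nT)) \<le> ?\<delta>"
    using affine[of "real KR / (real KT * real nT)" 0 \<mu>] bounds(2) K by (simp add: field_simps)
  show ?thesis
  proof (cases "\<mu> * real KT < max (1 - real KT * r / real nT) 0")
    case low: True
    have "ereal (real KR * (1 - \<mu> * real KT)) / ereal (real KT * r) \<le> ?\<delta>"
    proof (cases "r = 0")
      case True
      have "ereal M \<le> ?\<delta>" for M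
      proof -
        \<comment> \<open>Without fronthaul every valid policy has \<open>y * KT \<ge> 1\<close>,
          where \<open>c * (1 - y * KT)\<close> is at most 0; \<open>c\<close> is scaled so that
          this function equals \<open>max M 0\<close> at \<open>\<mu>\<close>. As \<open>M\<close>
          is arbitrary, the envelope is infinite.\<close>
        define c where "c = max M 0 / (1 - \<mu> * real KT)"
        have pos: "1 - \<mu> * real KT > 0" using low True by simp
        then have c: "c \<ge> 0" by (simp add: c_def)
        have "c + - (c * real KT) * y \<le> policy_ndt KT KR N r \<pi>"
          if "valid_policy KT KR nT N h r y \<pi>" for y \<pi>
        proof -
          have "1 - y * real KT \<le> 0"
            using bounds(3)[OF that] True K by (simp add: mult_le_0_iff)
          then have "c * (1 - y * real KT) \<le> 0" using c by (simp add: mult_le_0_iff)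
          then show ?thesis using bounds(1)[OF that] by (simp add: algebra_simps)
        qed
        then have "ereal (c + - (c * real KT) * \<mu>) \<le> ?\<delta>" by (rule affine)
        moreover have "c + - (c * real KT) * \<mu> = max M 0"
        proof -
          have "c + - (c * real KT) * \<mu> = c * (1 - \<mu> * real KT)"
            by (simp add: algebra_simps)
          then show ?thesis using pos by (simp add: c_def)
        qed
        moreover have "ereal M \<le> ereal (max M 0)" by simp
        ultimately show ?thesis by (metis order_trans)
      qed
      then have "?\<delta> = \<infinity>" by (rule ereal_top)
      then show ?thesis by simp
    next
      case False
      then have Kr: "real KT * r > 0" using K assms(7) by simp
      have "real KR / (real KT * r) + - (real KR * real KT / (real KT * r)) * y \<le> policy_ndt KT KR N r \<pi>"
        if "valid_policy KT KR nT N h r y \<pi>" for y \<pi>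
      proof -
        have "real KR / (real KT * r) + - (real KR * real KT / (real KT * r)) * y
          = real KR * (1 - y * real KT) / (real KT * r)"
          using Kr by (simp add: diff_divide_distrib right_diff_distrib mult_ac)
        also have "\<dots> \<le> policy_ndt KT KR N r \<pi>"
          using bounds(3)[OF that] Kr by (simp add: divide_le_eq mult_ac)
        finally show ?thesis .
      qed
      then have "ereal (real KR / (real KT * r) + - (real KR * real KT / (real KT * r)) * \<mu>) \<le> ?\<delta>" by (rule affine)
      moreover have "real KR / (real KT * r) + - (real KR * real KT / (real KT * r)) * \<mu>
          = real KR * (1 - \<mu> * real KT) / (real KT * r)"
        using Kr by (simp add: diff_divide_distrib right_diff_distrib mult_ac)
      ultimately show ?thesis using False K by auto
    qed
    then show ?thesis using low one by (simp add: pipelined_lower_bound_def)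
  next
    case high: False
    have "ereal (real KR / (m_p_star KT KR nT r \<mu> * real nT)) \<le> ?\<delta>"
    proof (cases "\<mu> * real KT \<le> ?M - real KT * r / (?M * real nT)")
      case True
      have root: "?a\<^sup>2 = \<mu> * real KT * ?a + real KT * r / real nT"
        by (rule m_eq_root) (use assms in auto)
      have \<mu>K: "0 \<le> \<mu> * real KT" using assms(5) by simp
      have a_ge: "\<mu> * real KT / 2 \<le> ?a"
        using assms(7) K by (simp add: m_eq_def)
      \<comment> \<open>If \<open>m_eq\<close> were 0, both \<open>\<mu> * KT\<close> and
        \<open>r\<close> would vanish; the threshold would be 1 and \<open>high\<close> would
        fail.\<close>
      have a: "?a > 0"
      proof (rule ccontr)
        assume "\<not> ?a > 0"
        with a_ge \<mu>K have "?a = 0" "\<mu> * real KT = 0" by linarith+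
        with root K have "real KT * r / real nT = 0" by simp
        with \<open>\<mu> * real KT = 0\<close> high show False by linarith
      qed
      \<comment> \<open>The coefficient of \<open>T\<close> in the tangent bound at
        \<open>a = m_eq\<close>.\<close>
      define D where "D = real nT * ?a\<^sup>2 + real KT * r"
      have D: "D > 0" using a K assms(7) by (simp add: D_def add_pos_nonneg)
      have "2 * real KR * ?a / D + - (real KR * real KT / D) * y \<le> policy_ndt KT KR N r \<pi>"
        if "valid_policy KT KR nT N h r y \<pi>" for y \<pi>
      proof -
        have "2 * real KR * ?a / D + - (real KR * real KT / D) * y
          = real KR * (2 * ?a - y * real KT) / D"
          using D by (simp add: field_simps)
        also have "\<dots> \<le> policy_ndt KT KR N r \<pi>"
          using bounds(4)[OF that, of ?a] D by (simp add: divide_le_eq D_def mult_ac)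
        finally show ?thesis .
      qed
      then have "ereal (2 * real KR * ?a / D + - (real KR * real KT / D) * \<mu>) \<le> ?\<delta>"
        by (rule affine)
      moreover have "2 * real KR * ?a / D + - (real KR * real KT / D) * \<mu>
          = real KR / (?a * real nT)"
      proof -
        \<comment> \<open>The root equation eliminates \<open>r\<close>; \<open>D\<close> then
          contains the factor \<open>2 * a - \<mu> * KT\<close>, which cancels against the
          numerator.\<close>
        have "real KT * r = real nT * (?a\<^sup>2 - \<mu> * real KT * ?a)"
          using root K by (simp add: field_simps)
        then have D': "D = real nT * ?a * (2 * ?a - \<mu> * real KT)"
          unfolding D_def by (simp add: algebra_simps power2_eq_square)
        have "2 * real KR * ?a / D + - (real KR * real KT / D) * \<mu>
          = real KR * (2 * ?a - \<mu> * real KT) / D"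
          using D by (simp add: field_simps)
        also have "\<dots> = real KR / (?a * real nT)"
          using D a K unfolding D' by (simp add: field_simps)
        finally show ?thesis .
      qed
      ultimately have "ereal (real KR / (?a * real nT)) \<le> ?\<delta>" by (simp only:)
      moreover have "m_p_star KT KR nT r \<mu> = max ?a 1"
        using True by (simp add: m_p_star_def)
      \<comment> \<open>Truncating \<open>m_eq\<close> at 1 only weakens the bound.\<close>
      moreover have "real KR / (max ?a 1 * real nT) \<le> real KR / (?a * real nT)"
        using a K by (intro divide_left_mono mult_right_mono) auto
      ultimately show ?thesis by (simp add: order_trans[rotated])
    next
      case False
      have eq: "real KR / (m_p_star KT KR nT r \<mu> * real nT) = real KR / (?M * real nT)"
        using False by (simp add: m_p_star_def)
      show ?thesis
      \<comment> \<open>If \<open>m_max\<close> is \<open>KT\<close>, \<open>const\<close> applies;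
        otherwise it is the ceiling of \<open>KR / nT\<close>, the quotient is at most 1, and
        \<open>one\<close> suffices.\<close>
      proof (cases "KT \<le> nat \<lceil>real KR / real nT\<rceil>")
        case True
        then have "?M = real KT" by (simp add: m_max_def)
        then show ?thesis using const unfolding eq by simp
      next
        case False
        have "real KR / real nT \<le> real (nat \<lceil>real KR / real nT\<rceil>)"
          by (rule real_nat_ceiling_ge)
        then have "real KR / real nT \<le> ?M"
          using False by (simp add: m_max_def)
        moreover from this have "?M > 0" using K by (smt (verit) divide_pos_pos)
        ultimately have "real KR / (?M * real nT) \<le> 1"
          using K by (simp add: field_simps)
        then have "ereal (real KR / (?M * real nT)) \<le> 1" by (simp add: one_ereal_def)
        with one show ?thesis unfolding eq by (rule order_trans[rotated])
      qed
    qed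
    then show ?thesis
      using high one by (simp add: pipelined_lower_bound_def one_ereal_def max_def)
  qed
qed

end
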